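(* For any number of steps $k\ge 1$ there exists a first-order explicit Adams-type method with stability interval of length $2k$. The method has the form $$y_{m+k}=y_{m+k-1}+\frac{\tau}{k^2}\Bigl(f_m+3f_{m+1}+\ldots+(2k-1)f_{m+k-1}\Bigr),$$ i.e. $\beta_j=(2j+1)/k^2$ for $j=0,1,\ldots,k-1$.
   Context: An explicit $k$-step Adams-type method with real coefficients $\beta_0,\ldots,\beta_{k-1}$ for the ODE system $y'=f(t,y)$, $y(t_0)=y_0$, with $y:\mathbb{R}\to\mathbb{R}^n$ and $f:\mathbb{R}\times\mathbb{R}^n\to\mathbb{R}^n$, on a uniform grid with discretization step $\tau$ is $$y_{m+k}=y_{m+k-1}+\tau(\beta_0 f_m+\ldots+\beta_{k-1}f_{m+k-1}),$$ where $m$ is the step number, $y_j\approx y(t_0+j\tau)$ and $f_j=f(t_0+j\tau,y_j)$. Its generating polynomials are $\rho(\zeta)=\zeta^k-\zeta^{k-1}$ and $\sigma(\zeta)=\sum_{j=0}^{k-1}\beta_j\zeta^j$. The order of the method is the usual order of consistency of a linear multistep method; for an Adams-type method the first-order condition is $\sum_{j=0}^{k-1}\beta_j=1$. The stability region $S\subset\mathbb{C}$ is the set of values $\lambda\tau$ for which the numerical solution of the model problem $y'=\lambda y$, $\lambda\in\mathbb{C}$, remains bounded for all $m$; equivalently, all roots $\zeta$ of the characteristic equation $\rho(\zeta)-\lambda\tau\,\sigma(\zeta)=0$ lie within the unit disc ($|\zeta|\le 1$), and all the roots of modulus one are simple. The stability interval of a method is the largest interval of the form $[-\ell,0]$ contained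 in $S$, and the value $\ell\ge 0$ is called the length of the stability interval.
   Formalization: For even k no largest interval [-l,0] in S exists (for k=2 the characteristic polynomial at -4 is (ζ+1)^2), so the length is taken as the supremum of l with [-l,0] contained in S; for odd k the closed interval [-2k,0] is also shown to lie in S. *)

theory Defs
  imports "HOL-Analysis.Analysis" "HOL-Library.Landau_Symbols"
begin

text \<open>
  An explicit \<open>k\<close>-step Adams-type method (\<open>k \<ge> 1\<close>) is given by its coefficients
  \<open>\<beta> 0, \<dots>, \<beta> (k - 1)\<close>; the values \<open>\<beta> j\<close> for \<open>j \<ge> k\<close> are never used.
  A sequence \<open>y\<close> is a numerical solution of \<open>y' = f(t, y)\<close> with step \<open>\<tau>\<close> if it satisfies the
  recurrence; the \<open>k\<close> starting values are left free.
\<close>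

definition adams_solution ::
    "nat \<Rightarrow> (nat \<Rightarrow> real) \<Rightarrow> (real \<Rightarrow> 'a \<Rightarrow> 'a::real_vector) \<Rightarrow> real \<Rightarrow> real \<Rightarrow> (nat \<Rightarrow> 'a) \<Rightarrow> bool" where
  "adams_solution k \<beta> f t0 \<tau> y \<longleftrightarrow>
     (\<forall>m. y (m + k) = y (m + k - 1)
            + \<tau> *\<^sub>R (\<Sum>j<k. \<beta> j *\<^sub>R f (t0 + real (m + j) * \<tau>) (y (m + j))))"

definition smooth_fun :: "(real \<Rightarrow> real) \<Rightarrow> bool" where
  "smooth_fun y \<longleftrightarrow> (\<forall>n t. (deriv ^^ n) y differentiable (at t))"

text \<open>
  The residual obtained by inserting an exact solution into the method; along an exact
  solution, \<open>f(s, y(s))\<close> equals \<open>y'(s)\<close>.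
\<close>

definition truncation_error :: "nat \<Rightarrow> (nat \<Rightarrow> real) \<Rightarrow> (real \<Rightarrow> real) \<Rightarrow> real \<Rightarrow> real \<Rightarrow> real" where
  "truncation_error k \<beta> y t \<tau> =
     y (t + real k * \<tau>) - y (t + real (k - 1) * \<tau>)
       - \<tau> * (\<Sum>j<k. \<beta> j * deriv y (t + real j * \<tau>))"

definition consistent_of_order :: "nat \<Rightarrow> (nat \<Rightarrow> real) \<Rightarrow> nat \<Rightarrow> bool" where
  "consistent_of_order k \<beta> p \<longleftrightarrow>
     (\<forall>y t. smooth_fun y \<longrightarrow> truncation_error k \<beta> y t \<in> O[at_right 0](\<lambda>\<tau>. \<tau> ^ (p + 1)))"

definition has_order :: "nat \<Rightarrow> (nat \<Rightarrow> real) \<Rightarrow> nat \<Rightarrow> bool" where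
  "has_order k \<beta> p \<longleftrightarrow> consistent_of_order k \<beta> p \<and> \<not> consistent_of_order k \<beta> (p + 1)"

text \<open>
  For the model problem the recurrence involves \<open>c\<close> and \<open>\<tau>\<close> only through \<open>c * \<tau>\<close>, so it does not
  matter which factorisation of \<open>z\<close> is chosen.
\<close>

definition stability_region :: "nat \<Rightarrow> (nat \<Rightarrow> real) \<Rightarrow> complex set" where
  "stability_region k \<beta> =
     {z. \<exists>c \<tau>. \<tau> > 0 \<and> z = c * complex_of_real \<tau> \<and>
           (\<forall>t0 y. adams_solution k \<beta> (\<lambda>t u. c * u) t0 \<tau> y \<longrightarrow> bounded (range y))}"

definition stable_on :: "nat \<Rightarrow> (nat \<Rightarrow> real) \<Rightarrow> real \<Rightarrow> bool" where
  "stable_on k \<beta> l \<longleftrightarrow> complex_of_real ` {- l..0} \<subseteq> stability_region k \<beta>"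

text \<open>
  The length is a supremum because a largest interval \<open>[- l, 0]\<close> inside the stability region
  need not exist: see the lemma below, where the characteristic polynomial at the left
  endpoint \<open>- 4\<close> is \<open>(\<zeta> + 1)\<^sup>2\<close>, while all of \<open>(- 4, 0]\<close> belongs to the region.
\<close>

definition stability_length :: "nat \<Rightarrow> (nat \<Rightarrow> real) \<Rightarrow> ereal" where
  "stability_length k \<beta> = (SUP l\<in>{l. 0 \<le> l \<and> stable_on k \<beta> l}. ereal l)"

lemma two_step_endpoint_unstable:
  "- 4 \<notin> stability_region 2 (\<lambda>j. (2 * real j + 1) / (real 2)\<^sup>2)"
proof
  let ?\<beta> = "\<lambda>j. (2 * real j + 1) / (real 2)\<^sup>2"
  let ?y = "\<lambda>m. of_nat m * (- 1) ^ m :: complex"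
  assume "- 4 \<in> stability_region 2 ?\<beta>"
  then obtain c \<tau> where z: "c * complex_of_real \<tau> = - 4"
    and bdd: "\<And>t0 y. adams_solution 2 ?\<beta> (\<lambda>t u. c * u) t0 \<tau> y \<Longrightarrow> bounded (range y)"
    unfolding stability_region_def by auto
  have z': "complex_of_real \<tau> * (c * w) = - 4 * w" for w
    using z by (metis mult.assoc mult.commute)
  have rhs: "\<tau> *\<^sub>R (\<Sum>j<2. ?\<beta> j *\<^sub>R (c * ?y (m + j))) = - (?y m) - 3 * ?y (m + 1)" for m
  proof -
    have "\<tau> *\<^sub>R (\<Sum>j<2. ?\<beta> j *\<^sub>R (c * ?y (m + j)))
        = (complex_of_real \<tau> * (c * ?y m)) / 4 + 3 * (complex_of_real \<tau> * (c * ?y (m + 1))) / 4"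
      by (simp add: numeral_2_eq_2 scaleR_conv_of_real field_simps)
    then show ?thesis unfolding z' by simp
  qed
  have "adams_solution 2 ?\<beta> (\<lambda>t u. c * u) 0 \<tau> ?y"
    unfolding adams_solution_def rhs by (auto simp: algebra_simps)
  from bdd[OF this] obtain B where B: "\<And>m. norm (?y m) \<le> B"
    unfolding bounded_iff by auto
  obtain m :: nat where "B < real m"
    using reals_Archimedean2 by blast
  with B[of m] show False
    by (simp add: norm_mult norm_power)
qed

end

theory Submission
  imports Defs
    "HOL-Complex_Analysis.Complex_Analysis"
    "HOL-Computational_Algebra.Fundamental_Theorem_Algebra"
begin

text \<open>
  In the variable \<open>w = 1 / \<zeta>\<close> the characteristic polynomial at \<open>- x\<close> becomes
  \<open>(1 - w) (1 + (x / k\<^sup>2) g w)\<close> with \<open>g w = (\<Sum>j<k. (2 j + 1) w ^ (k - j)) / (1 - w)\<close>. With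
  \<open>c = (1 + w) / (1 - w)\<close> one finds \<open>g w = (c\<^sup>2 - 1) / 4 * (2 k - c (1 - w ^ k))\<close>. On the unit circle
  \<open>c\<close> is imaginary, so the imaginary part of \<open>g\<close> is nonnegative on the upper unit semicircle; by the
  maximum principle and the open mapping theorem \<open>g\<close> is not real in the open upper half disc, and
  no root \<open>\<zeta>\<close> outside the unit disc is nonreal. Real roots are excluded by an elementary estimate.
  On the unit circle \<open>g\<close> is real only if \<open>w ^ k = 1\<close> or \<open>w = - 1\<close>, and there the
  derivative shows that the root is simple. For \<open>x > 2 k\<close> there is a real root \<open>\<zeta> < - 1\<close>.
\<close>

subsection \<open>The root condition for linear recurrences\<close>

text \<open>The operator \<open>p(E)\<close> applied to \<open>y\<close>, with \<open>E\<close> the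
  forward shift. Sequences become a module over the polynomial ring, so that factoring a
  characteristic polynomial means composing operators.\<close>

definition shift_apply :: "'a::comm_ring_1 poly \<Rightarrow> (nat \<Rightarrow> 'a) \<Rightarrow> nat \<Rightarrow> 'a" where
  "shift_apply p y m = (\<Sum>i\<le>degree p. coeff p i * y (m + i))"

lemma shift_apply_altdef:
  assumes "degree p \<le> n"
  shows "shift_apply p y m = (\<Sum>i\<le>n. coeff p i * y (m + i))"
  unfolding shift_apply_def
proof (rule sum.mono_neutral_left)
  show "\<forall>i\<in>{..n} - {..degree p}. coeff p i * y (m + i) = 0"
    by (simp add: coeff_eq_0)
qed (use assms in auto)

lemma shift_apply_0 [simp]: "shift_apply 0 y = (\<lambda>_. 0)"
  by (simp add: shift_apply_def fun_eq_iff)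

lemma shift_apply_add: "shift_apply (p + q) y m = shift_apply p y m + shift_apply q y m"
proof -
  let ?n = "max (degree p) (degree q)"
  have "degree (p + q) \<le> ?n" by (rule degree_add_le_max)
  then show ?thesis
    by (simp add: shift_apply_altdef[of _ ?n] distrib_right sum.distrib)
qed

lemma shift_apply_smult: "shift_apply (smult c p) y m = c * shift_apply p y m"
  by (simp add: shift_apply_altdef[of _ "degree p"] sum_distrib_left mult.assoc degree_smult_le)

lemma shift_apply_pCons:
  "shift_apply (pCons a p) y m = a * y m + shift_apply p y (Suc m)"
  by (simp add: shift_apply_altdef[of "pCons a p" "Suc (degree p)"] degree_pCons_le
      sum.atMost_Suc_shift shift_apply_def del: sum.atMost_Suc)

lemma shift_apply_minus: "shift_apply (- p) y m = - shift_apply p y m"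
  using shift_apply_smult[of "-1" p y m] by simp

lemma shift_apply_diff: "shift_apply (p - q) y m = shift_apply p y m - shift_apply q y m"
  using shift_apply_add[of p "- q" y m] by (simp add: shift_apply_minus)

lemma shift_apply_sum: "shift_apply (sum f A) y m = (\<Sum>i\<in>A. shift_apply (f i) y m)"
  by (induction A rule: infinite_finite_induct) (simp_all add: shift_apply_add)

lemma shift_apply_monom: "shift_apply (monom c n) y m = c * y (m + n)"
  by (induction n arbitrary: m) (simp_all add: monom_0 monom_Suc shift_apply_pCons)

lemma shift_apply_mult: "shift_apply (p * q) y = shift_apply p (shift_apply q y)"
proof (rule ext)
  show "shift_apply (p * q) y m = shift_apply p (shift_apply q y) m" for m
    by (induction p arbitrary: m) (simp_all add: shift_apply_add shift_apply_smult shift_apply_pCons)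
qed

lemma bounded_shift_apply:
  fixes u :: "nat \<Rightarrow> complex"
  assumes "bounded (range u)"
  shows "bounded (range (shift_apply p u))"
proof (induction p)
  case 0
  then show ?case by (simp add: image_constant_conv)
next
  case (pCons a p)
  obtain B C where "\<And>m. norm (u m) \<le> B" "\<And>m. norm (shift_apply p u m) \<le> C"
    using assms pCons.IH unfolding bounded_iff by auto
  then have "norm (a * u m + shift_apply p u (Suc m)) \<le> norm a * B + C" for m
    by (intro order.trans[OF norm_triangle_ineq] add_mono) (simp_all add: norm_mult mult_left_mono)
  then show ?case
    unfolding bounded_iff by (auto simp: shift_apply_pCons)
qed

text \<open>In \<open>u (m + 1) = r * u m + O(1)\<close> the old value is contracted by
  \<open>norm r < 1\<close>, so a sufficiently large bound reproduces itself.\<close>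

lemma bounded_of_linear_factor:
  fixes u :: "nat \<Rightarrow> complex"
  assumes "bounded (range (shift_apply [:- r, 1:] u))" "norm r < 1"
  shows "bounded (range u)"
proof -
  obtain B where B: "\<And>m. norm (u (Suc m) - r * u m) \<le> B"
    using assms(1) unfolding bounded_iff by (auto simp: shift_apply_pCons)
  \<comment> \<open>\<open>B / (1 - norm r)\<close> is the fixed point of
    \<open>x \<mapsto> norm r * x + B\<close>; adding \<open>norm (u 0)\<close> covers the start of
    the induction.\<close>
  define K where "K = norm (u 0) + B / (1 - norm r)"
  have "B \<ge> 0" using B[of 0] norm_ge_zero order.trans by blast
  have K: "norm r * K + B \<le> K"
  proof -
    define b where "b = B / (1 - norm r)"
    have "B = b * (1 - norm r)" using assms(2) by (simp add: b_def)
    then show ?thesis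
      using assms(2) mult_left_le_one_le[of "norm (u 0)" "norm r"]
      unfolding K_def b_def[symmetric] by (simp add: algebra_simps)
  qed
  have "norm (u m) \<le> K" for m
  proof (induction m)
    case 0
    then show ?case using assms(2) \<open>B \<ge> 0\<close> by (simp add: K_def)
  next
    case (Suc m)
    have "norm (u (Suc m)) \<le> norm (r * u m) + norm (u (Suc m) - r * u m)"
      by (rule norm_triangle_sub)
    also have "\<dots> \<le> norm r * K + B"
      using Suc B by (intro add_mono) (auto simp: norm_mult mult_left_mono)
    finally show ?case using K by simp
  qed
  then show ?thesis unfolding bounded_iff by auto
qed

text \<open>
  The polynomials \<open>p\<close> for which \<open>p(E) y\<close> is bounded, where \<open>E\<close> is the shift, form an ideal.
  A root of modulus one of its generator would be a double root of \<open>P\<close>, and a root of smaller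
  modulus can be cancelled; so the generator is constant.
\<close>

lemma bounded_of_root_condition:
  fixes P :: "complex poly"
  assumes "P \<noteq> 0" and sol: "shift_apply P y = (\<lambda>_. 0)"
    and roots: "\<And>r. poly P r = 0 \<Longrightarrow> norm r < 1 \<or> norm r = 1 \<and> \<not> [:- r, 1:]\<^sup>2 dvd P"
  shows "bounded (range y)"
proof -
  define I where "I = {p. bounded (range (shift_apply p y))}"
  have "P \<in> I" by (simp add: I_def sol image_constant_conv)
  then obtain d where d: "d \<in> I" "d \<noteq> 0"
    and min: "\<And>p. p \<in> I \<Longrightarrow> p \<noteq> 0 \<Longrightarrow> degree d \<le> degree p"
    using ex_has_least_nat[of "\<lambda>p. p \<in> I \<and> p \<noteq> 0" P degree] \<open>P \<noteq> 0\<close> by auto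
  have dvd: "d dvd p" if "p \<in> I" for p
  proof (rule ccontr)
    assume "\<not> d dvd p"
    then have ne: "p mod d \<noteq> 0" by (simp add: mod_eq_0_iff_dvd)
    have "bounded (range (shift_apply ((p div d) * d) y))"
      using d(1) bounded_shift_apply[of "shift_apply d y"] by (simp add: I_def shift_apply_mult)
    moreover have "shift_apply (p mod d) y = (\<lambda>m. shift_apply p y m - shift_apply ((p div d) * d) y m)"
      unfolding minus_div_mult_eq_mod[symmetric] by (simp add: shift_apply_diff fun_eq_iff)
    ultimately have "p mod d \<in> I"
      using that by (auto simp: I_def intro: bounded_minus_comp)
    then show False
      using min ne d(2) degree_mod_less[of d p] by fastforce
  qed
  have "degree d = 0"
  proof (rule ccontr)
    assume "degree d \<noteq> 0"
    then obtain r where "poly d r = 0"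
      using Fundamental_Theorem_Algebra.fundamental_theorem_of_algebra[of d] constant_degree[of d]
    by auto
    then obtain e where e: "d = [:- r, 1:] * e" by (auto simp: poly_eq_0_iff_dvd dvd_def)
    have "e \<noteq> 0" using e d(2) by auto
    have "degree d = Suc (degree e)" unfolding e using \<open>e \<noteq> 0\<close> by (subst degree_mult_eq) auto
    then have e_notin: "e \<notin> I" using min \<open>e \<noteq> 0\<close> by fastforce
    have "poly P r = 0" using dvd[OF \<open>P \<in> I\<close>] \<open>poly d r = 0\<close> by (auto simp: dvd_def)
    then consider "norm r < 1" | "norm r = 1" "\<not> [:- r, 1:]\<^sup>2 dvd P" using roots by blast
    then show False
    proof cases
      case 1
      then show False
        using d(1) e_notin bounded_of_linear_factor[of r "shift_apply e y"]
        unfolding I_def e mem_Collect_eq shift_apply_mult by blast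
    next
      case 2
      obtain Q where Q: "P = [:- r, 1:] * Q" using \<open>poly P r = 0\<close> by (auto simp: poly_eq_0_iff_dvd dvd_def)
      \<comment> \<open>As \<open>P\<close> annihilates \<open>y\<close>, the sequence
        \<open>shift_apply Q y\<close> is geometric with a ratio of modulus one, hence bounded. So
        \<open>Q\<close> lies in the ideal, and the generator brings a second factor for
        \<open>r\<close> into \<open>P\<close>.\<close>
      have step: "shift_apply Q y (Suc m) = r * shift_apply Q y m" for m
        using fun_cong[OF sol, of m] unfolding Q shift_apply_mult by (simp add: shift_apply_pCons)
      have "norm (shift_apply Q y m) = norm (shift_apply Q y 0)" for m
        by (induction m) (simp_all add: step norm_mult 2)
      then have "bounded (range (shift_apply Q y))"
        unfolding bounded_iff by (metis order.refl rangeE)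
      then have "Q \<in> I" by (simp add: I_def)
      then have "[:- r, 1:] dvd Q" using dvd e dvd_mult_left by metis
      then have "[:- r, 1:]\<^sup>2 dvd P" unfolding Q power2_eq_square by (rule mult_dvd_mono[OF dvd_refl])
      then show False using 2 by simp
    qed
  qed
  then obtain c where c: "d = [:c:]" by (metis degree_eq_zeroE)
  with d have "c \<noteq> 0" by auto
  \<comment> \<open>A constant generator is invertible, so \<open>y\<close> is a multiple of a
    bounded sequence.\<close>
  have "shift_apply [:inverse c:] (shift_apply d y) = y"
    using \<open>c \<noteq> 0\<close> by (simp add: c shift_apply_pCons fun_eq_iff)
  then show ?thesis
    using d(1) bounded_shift_apply[of "shift_apply d y" "[:inverse c:]"] by (simp add: I_def)
qed

section \<open>The characteristic polynomial and the stability region\<close>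

text \<open>The characteristic polynomial \<open>rho - z * sigma\<close> of the method.\<close>

definition adams_poly :: "nat \<Rightarrow> (nat \<Rightarrow> real) \<Rightarrow> complex \<Rightarrow> complex poly" where
  "adams_poly k \<beta> z =
     monom 1 k - monom 1 (k - 1) - smult z (\<Sum>j<k. monom (complex_of_real (\<beta> j)) j)"

lemma poly_adams_poly:
  "poly (adams_poly k \<beta> z) \<zeta> = \<zeta> ^ k - \<zeta> ^ (k - 1) - z * (\<Sum>j<k. complex_of_real (\<beta> j) * \<zeta> ^ j)"
  by (simp add: adams_poly_def poly_monom poly_sum)

lemma adams_poly_nonzero:
  assumes "k \<ge> 1"
  shows "adams_poly k \<beta> z \<noteq> 0"
proof -
  \<comment> \<open>The method is explicit: \<open>sigma\<close> has degree below \<open>k\<close>,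
    so the leading coefficient does not depend on \<open>z\<close>.\<close>
  have "coeff (adams_poly k \<beta> z) k = 1"
    using assms by (auto simp: adams_poly_def coeff_sum)
  then show ?thesis by auto
qed

lemma adams_solution_linear_iff:
  "adams_solution k \<beta> (\<lambda>t u. c * u) t0 \<tau> y \<longleftrightarrow>
     shift_apply (adams_poly k \<beta> (c * complex_of_real \<tau>)) y = (\<lambda>_. 0)"
  if "k \<ge> 1"
proof -
  have "shift_apply (adams_poly k \<beta> (c * complex_of_real \<tau>)) y m =
      y (m + k) - y (m + (k - 1)) - \<tau> *\<^sub>R (\<Sum>j<k. \<beta> j *\<^sub>R (c * y (m + j)))" for m
    unfolding adams_poly_def shift_apply_diff shift_apply_smult shift_apply_sum shift_apply_monom
    by (simp add: scaleR_conv_of_real sum_distrib_left mult_ac)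
  then show ?thesis
    using that by (simp add: adams_solution_def fun_eq_iff diff_eq_eq add.commute)
qed

lemma stability_region_if_root_condition:
  assumes "k \<ge> 1"
    and "\<And>r. poly (adams_poly k \<beta> z) r = 0 \<Longrightarrow>
           norm r < 1 \<or> norm r = 1 \<and> \<not> [:- r, 1:]\<^sup>2 dvd adams_poly k \<beta> z"
  shows "z \<in> stability_region k \<beta>"
proof -
  \<comment> \<open>The factorisation with \<open>c = z\<close> and step 1 serves as the witness for
    membership.\<close>
  have "bounded (range y)" if "adams_solution k \<beta> (\<lambda>t u. z * u) t0 1 y" for t0 y
  proof (rule bounded_of_root_condition[OF adams_poly_nonzero[OF assms(1)] _ assms(2)])
    show "shift_apply (adams_poly k \<beta> z) y = (\<lambda>_. 0)"
      using that by (simp add: adams_solution_linear_iff[OF assms(1)])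
  qed
  then show ?thesis
    unfolding stability_region_def by (intro CollectI exI[of _ z] exI[of _ "1::real"]) auto
qed

text \<open>A root \<open>r\<close> yields the numerical solution \<open>r ^ m\<close>, unbounded
  for \<open>norm r > 1\<close>. This half of the root condition gives the upper bound on the
  length.\<close>

lemma norm_root_le_1_if_stable:
  assumes "k \<ge> 1" "z \<in> stability_region k \<beta>" "poly (adams_poly k \<beta> z) r = 0"
  shows "norm r \<le> 1"
proof (rule ccontr)
  assume "\<not> norm r \<le> 1"
  obtain c \<tau> where z: "z = c * complex_of_real \<tau>"
    and bdd: "\<And>t0 y. adams_solution k \<beta> (\<lambda>t u. c * u) t0 \<tau> y \<Longrightarrow> bounded (range y)"
    using assms(2) unfolding stability_region_def by auto
  have "shift_apply p (\<lambda>m. r ^ m) m = r ^ m * poly p r" for p m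
    by (induction p arbitrary: m) (simp_all add: shift_apply_pCons algebra_simps)
  then have "adams_solution k \<beta> (\<lambda>t u. c * u) 0 \<tau> (\<lambda>m. r ^ m)"
    using assms(3) by (simp add: adams_solution_linear_iff[OF assms(1)] z[symmetric] fun_eq_iff)
  from bdd[OF this] obtain B where "\<And>m. norm r ^ m \<le> B"
    unfolding bounded_iff by (auto simp: norm_power)
  moreover obtain m where "B < norm r ^ m"
    using real_arch_pow \<open>\<not> norm r \<le> 1\<close> by (meson not_le)
  ultimately show False by (meson not_le)
qed

subsection \<open>The kernel \<open>g\<close> on the unit disc\<close>

text \<open>The reversal \<open>k^2 * w^k * sigma(1 / w)\<close> of the second generating polynomial
  of the method.\<close>

definition odd_sum :: "nat \<Rightarrow> 'a::comm_ring_1 \<Rightarrow> 'a" where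
  "odd_sum k w = (\<Sum>j<k. (2 * of_nat j + 1) * w ^ (k - j))"

lemma odd_sum_Suc: "odd_sum (Suc k) w = w * (odd_sum k w + 2 * of_nat k + 1)"
proof -
  have "(\<Sum>j<k. (2 * of_nat j + 1) * w ^ (Suc k - j)) = w * odd_sum k w"
    unfolding odd_sum_def sum_distrib_left
    by (intro sum.cong) (auto simp: Suc_diff_le)
  then show ?thesis by (simp add: odd_sum_def algebra_simps)
qed

lemma odd_sum_0 [simp]: "odd_sum 0 w = 0"
  by (simp add: odd_sum_def)

text \<open>The arithmetic-geometric series, kept free of division so that it holds in every
  commutative ring and also at \<open>w = 1\<close>.\<close>

lemma odd_sum_closed:
  "(1 - w)\<^sup>2 * odd_sum k w = w * (2 * of_nat k * (1 - w) - (1 + w) * (1 - w ^ k))"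
proof (induction k)
  case 0
  then show ?case by simp
next
  case (Suc k)
  have "(1 - w)\<^sup>2 * odd_sum (Suc k) w = w * ((1 - w)\<^sup>2 * odd_sum k w + (1 - w)\<^sup>2 * (2 * of_nat k + 1))"
    by (simp add: odd_sum_Suc algebra_simps)
  also have "\<dots> = w * (2 * of_nat (Suc k) * (1 - w) - (1 + w) * (1 - w ^ Suc k))"
    unfolding Suc.IH by (simp add: algebra_simps power2_eq_square)
  finally show ?case .
qed

lemma odd_sum_at_1: "odd_sum k (1::'a::comm_ring_1) = of_nat (k\<^sup>2)"
  by (induction k) (simp_all add: odd_sum_Suc power2_eq_square algebra_simps)

lemma odd_sum_at_minus_1: "odd_sum k (- 1 :: real) = - real k"
  by (induction k) (simp_all add: odd_sum_Suc)

lemma cnj_odd_sum: "cnj (odd_sum k w) = odd_sum k (cnj w)"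
  by (simp add: odd_sum_def)

lemma odd_sum_of_real: "odd_sum k (complex_of_real t) = of_real (odd_sum k t)"
  by (simp add: odd_sum_def)

section \<open>Sign of the imaginary part of \<open>g\<close> on the upper half disc\<close>

text \<open>Induction through \<open>Im (w * v) = Re w * Im v + Im w * Re v\<close> with
  \<open>v = w ^ n\<close>, both real parts having modulus at most 1.\<close>

lemma abs_Im_power_le:
  assumes "norm w \<le> 1"
  shows "\<bar>Im (w ^ n)\<bar> \<le> real n * \<bar>Im w\<bar>"
proof (induction n)
  case 0
  then show ?case by simp
next
  case (Suc n)
  have "norm (w ^ n) \<le> 1" using assms by (simp add: norm_power power_le_one)
  then have "\<bar>Re (w ^ n)\<bar> \<le> 1" "\<bar>Re w\<bar> \<le> 1"
    using assms abs_Re_le_cmod order.trans by blast+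
  then have "\<bar>Re w * Im (w ^ n)\<bar> \<le> 1 * (real n * \<bar>Im w\<bar>)" "\<bar>Im w * Re (w ^ n)\<bar> \<le> \<bar>Im w\<bar> * 1"
    unfolding abs_mult using Suc by (intro mult_mono mult_left_mono; simp)+
  then show ?case by (simp add: algebra_simps)
qed

lemma Im_cayley: "Im ((1 + w) / (1 - w)) = 2 * Im w / (norm (1 - w))\<^sup>2"
  by (simp add: Im_divide cmod_def field_simps)

lemma Re_cayley: "Re ((1 + w) / (1 - w)) = (1 - (norm w)\<^sup>2) / (norm (1 - w))\<^sup>2"
  unfolding Re_divide cmod_power2 by (simp add: algebra_simps power2_eq_square)

text \<open>The closed form divided by \<open>(1 - w) ^ 3\<close>, rewritten with
  \<open>w / (1 - w)^2 = (c^2 - 1) / 4\<close>.\<close>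

lemma odd_sum_div_cayley:
  fixes w :: complex
  assumes "w \<noteq> 1"
  defines "c \<equiv> (1 + w) / (1 - w)"
  shows "odd_sum k w / (1 - w) = (c\<^sup>2 - 1) / 4 * (2 * of_nat k - c * (1 - w ^ k))"
proof -
  have "odd_sum k w / (1 - w) = ((1 - w)\<^sup>2 * odd_sum k w) / (1 - w) ^ 3"
    using assms(1) by (simp add: power2_eq_square power3_eq_cube)
  also have "\<dots> = w * (2 * of_nat k * (1 - w) - (1 + w) * (1 - w ^ k)) / (1 - w) ^ 3"
    by (simp only: odd_sum_closed)
  also have "\<dots> = w / (1 - w)\<^sup>2 * (2 * of_nat k - c * (1 - w ^ k))"
    using assms(1) by (simp add: c_def power2_eq_square power3_eq_cube field_simps)
  also have "w / (1 - w)\<^sup>2 = (c\<^sup>2 - 1) / 4"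
    using assms(1) by (simp add: c_def power2_eq_square divide_simps) (simp add: algebra_simps)
  finally show ?thesis .
qed

lemma Im_of_real_mult: "Im (of_real r * z) = r * Im z"
  by simp

text \<open>On the circle \<open>c\<close> is \<open>\<i> * t\<close>, so \<open>c^2 - 1\<close> is
  the real number \<open>-(t^2 + 1)\<close>, and only the term \<open>c * (1 - w ^ k)\<close>
  contributes to the imaginary part.\<close>

lemma Im_odd_sum_div_circle:
  assumes "norm w = 1" "w \<noteq> 1"
  shows "\<exists>t. (1 + w) / (1 - w) = \<i> * of_real t \<and>
           Im (odd_sum k w / (1 - w)) = (t\<^sup>2 + 1) / 4 * t * Re (1 - w ^ k)"
proof -
  define t where "t = Im ((1 + w) / (1 - w))"
  have c: "(1 + w) / (1 - w) = \<i> * of_real t"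
    using assms by (simp add: complex_eq_iff t_def Re_cayley)
  have "(\<i> * of_real t)\<^sup>2 - 1 = of_real (- (t\<^sup>2 + 1))"
    by (simp add: power_mult_distrib)
  then have "odd_sum k w / (1 - w) =
      of_real (- (t\<^sup>2 + 1) / 4) * (2 * of_nat k - \<i> * of_real t * (1 - w ^ k))"
    unfolding odd_sum_div_cayley[OF assms(2)] c by simp
  also have "Im \<dots> = - (t\<^sup>2 + 1) / 4 * Im (2 * of_nat k - \<i> * of_real t * (1 - w ^ k))"
    by (rule Im_of_real_mult)
  also have "\<dots> = (t\<^sup>2 + 1) / 4 * t * Re (1 - w ^ k)"
    by (simp add: algebra_simps)
  finally show ?thesis using c by blast
qed

text \<open>Each term is \<open>w ^ n / (1 - w) = 1 / (1 - w) - (\<Sum>i<n. w ^ i)\<close>. The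
  first part has imaginary part \<open>Im w / (norm (1 - w))^2\<close>, at least
  \<open>k^2 * Im w\<close> this close to 1; the sum contributes at most
  \<open>n * k * Im w\<close>.\<close>

lemma Im_odd_sum_div_near_1:
  assumes "norm w \<le> 1" "Im w \<ge> 0" "w \<noteq> 1" "norm (1 - w) \<le> 1 / real k" "k \<ge> 1"
  shows "Im (odd_sum k w / (1 - w)) \<ge> 0"
proof -
  have "Im (w ^ n / (1 - w)) \<ge> 0" if "n \<le> k" for n
  proof -
    have "w ^ n / (1 - w) = 1 / (1 - w) - (1 - w ^ n) / (1 - w)"
      by (simp add: diff_divide_distrib)
    also have "(1 - w ^ n) / (1 - w) = (\<Sum>i<n. w ^ i)"
      using assms(3) one_diff_power_eq[of w n] by (simp add: field_simps)
    finally have "Im (w ^ n / (1 - w)) = Im (1 / (1 - w)) - (\<Sum>i<n. Im (w ^ i))" by simp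
    moreover have "(\<Sum>i<n. Im (w ^ i)) \<le> real (card {..<n}) * (real k * Im w)"
    proof (rule sum_bounded_above)
      fix i assume "i \<in> {..<n}"
      then have "real i * Im w \<le> real k * Im w" using that assms(2) by (intro mult_right_mono) auto
      then show "Im (w ^ i) \<le> real k * Im w"
        using abs_Im_power_le[OF assms(1), of i] assms(2) by simp
    qed
    moreover have "real n * (real k * Im w) \<le> (real k)\<^sup>2 * Im w"
      using that assms(2) unfolding power2_eq_square mult.assoc by (intro mult_right_mono) auto
    moreover have "(real k)\<^sup>2 * Im w \<le> Im (1 / (1 - w))"
    proof -
      have pos: "norm (1 - w) > 0" using assms(3) by simp
      have "(real k * norm (1 - w))\<^sup>2 \<le> 1"
        using assms(4,5) by (intro power_le_one) (auto simp: field_simps)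
      then have "(real k)\<^sup>2 * Im w * (norm (1 - w))\<^sup>2 \<le> Im w"
        using mult_right_mono[OF _ assms(2)] by (fastforce simp: power_mult_distrib mult_ac)
      then have "(real k)\<^sup>2 * Im w \<le> Im w / (norm (1 - w))\<^sup>2"
        using pos by (simp add: pos_le_divide_eq)
      also have "\<dots> = Im (1 / (1 - w))"
        by (simp add: Im_divide cmod_power2)
      finally show ?thesis .
    qed
    ultimately show ?thesis by simp
  qed
  then have "(2 * real j + 1) * Im (w ^ (k - j) / (1 - w)) \<ge> 0" for j
    by simp
  moreover have "Im (odd_sum k w / (1 - w)) = (\<Sum>j<k. (2 * real j + 1) * Im (w ^ (k - j) / (1 - w)))"
  proof -
    have "odd_sum k w / (1 - w) = (\<Sum>j<k. of_real (2 * real j + 1) * (w ^ (k - j) / (1 - w)))"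
      by (simp add: odd_sum_def sum_divide_distrib)
    then show ?thesis by (simp only: Im_sum Im_of_real_mult)
  qed
  ultimately show ?thesis by (simp add: sum_nonneg)
qed

lemma holomorphic_odd_sum_div: "1 \<notin> S \<Longrightarrow> (\<lambda>w. odd_sum k w / (1 - w)) holomorphic_on S"
  unfolding odd_sum_def by (intro holomorphic_intros) auto

text \<open>
  Near the pole \<open>1\<close> the sign is read off termwise, so the maximum principle
  is only needed on the half disc with a neighbourhood of \<open>1\<close> removed.
\<close>

lemma Im_odd_sum_div_nonneg:
  assumes "norm w < 1" "Im w > 0" "k \<ge> 1"
  shows "Im (odd_sum k w / (1 - w)) \<ge> 0"
proof (cases "norm (1 - w) \<le> 1 / real k")
  case True
  then show ?thesis using assms by (intro Im_odd_sum_div_near_1) auto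
next
  case False
  define S where "S = {z. norm z < 1 \<and> Im z > 0 \<and> norm (1 - z) > 1 / real k}"
  \<comment> \<open>\<open>C\<close> is a closed set containing \<open>S\<close> and avoiding the
    pole 1, so \<open>g\<close> is holomorphic on it and continuous up to the frontier of
    \<open>S\<close>.\<close>
  define C where "C = {z. norm z \<le> 1 \<and> Im z \<ge> 0 \<and> norm (1 - z) \<ge> 1 / real k}"
  have "open S" unfolding S_def by (intro open_Collect_conj open_Collect_less continuous_intros)
  have "closed C" unfolding C_def by (intro closed_Collect_conj closed_Collect_le continuous_intros)
  moreover have "S \<subseteq> C" by (auto simp: S_def C_def)
  ultimately have "closure S \<subseteq> C" by (rule closure_minimal[rotated])
  have "1 \<notin> C" using assms(3) by (auto simp: C_def)
  \<comment> \<open>The factor \<open>\<i>\<close> turns a lower bound on the imaginary part of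
    \<open>g\<close> into an upper bound on a real part, as the maximum principle requires.\<close>
  have hol: "(\<lambda>z. \<i> * (odd_sum k z / (1 - z))) holomorphic_on C"
    by (intro holomorphic_on_mult holomorphic_on_const holomorphic_odd_sum_div) fact
  have "Re (\<i> * (odd_sum k w / (1 - w))) \<le> 0"
  proof (rule maximum_real_frontier[of "\<lambda>z. \<i> * (odd_sum k z / (1 - z))" S])
    show "(\<lambda>z. \<i> * (odd_sum k z / (1 - z))) holomorphic_on interior S"
      using hol \<open>S \<subseteq> C\<close> interior_subset holomorphic_on_subset by (metis order.trans)
    show "continuous_on (closure S) (\<lambda>z. \<i> * (odd_sum k z / (1 - z)))"
      using hol \<open>closure S \<subseteq> C\<close> holomorphic_on_imp_continuous_on continuous_on_subset by blast
    show "bounded S" by (rule bounded_subset[of "ball 0 1"]) (auto simp: S_def)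
    show "w \<in> S" using assms False by (simp add: S_def)
    fix z assume "z \<in> frontier S"
    then have "z \<in> C" "z \<notin> S"
      using \<open>closure S \<subseteq> C\<close> \<open>open S\<close> by (auto simp: frontier_def interior_open)
    then have z: "norm z \<le> 1" "Im z \<ge> 0" "z \<noteq> 1" using \<open>1 \<notin> C\<close> by (auto simp: C_def)
    from \<open>z \<in> C\<close> \<open>z \<notin> S\<close> consider "norm z = 1" | "Im z = 0" | "norm (1 - z) \<le> 1 / real k"
      by (auto simp: C_def S_def)
    \<comment> \<open>The frontier lies on the unit circle, on the real axis or close to 1; the sign
      comes from the circle formula, from \<open>g\<close> being real, and from the termwise
      estimate respectively.\<close>
    then have "Im (odd_sum k z / (1 - z)) \<ge> 0"
    proof cases
      case 1
      obtain t where t: "(1 + z) / (1 - z) = \<i> * of_real t"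
        "Im (odd_sum k z / (1 - z)) = (t\<^sup>2 + 1) / 4 * t * Re (1 - z ^ k)"
        using Im_odd_sum_div_circle[OF 1 z(3)] by blast
      have "t = 2 * Im z / (norm (1 - z))\<^sup>2"
        using Im_cayley[of z] unfolding t(1) by simp
      then have "t \<ge> 0" using z(2) by simp
      moreover have "Re (z ^ k) \<le> 1"
        using complex_Re_le_cmod[of "z ^ k"] 1 by (simp add: norm_power)
      ultimately show ?thesis unfolding t(2) by simp
    next
      case 2
      then have "z = of_real (Re z)" by (simp add: complex_eq_iff)
      then have "odd_sum k z / (1 - z) = of_real (odd_sum k (Re z) / (1 - Re z))"
        by (metis of_real_1 of_real_diff of_real_divide odd_sum_of_real)
      then show ?thesis by simp
    next
      case 3
      then show ?thesis using z assms(3) by (intro Im_odd_sum_div_near_1) auto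
    qed
    then show "Re (\<i> * (odd_sum k z / (1 - z))) \<le> 0"
      by (simp del: times_divide_eq_right)
  qed
  then show ?thesis by (simp del: times_divide_eq_right)
qed

text \<open>If \<open>g\<close> took the real value \<open>r\<close>, its open image would contain
  points just below \<open>r\<close>, with negative imaginary part. A constant \<open>g\<close>
  would equal \<open>g 0 = 0\<close>, which differs from \<open>r\<close>.\<close>

lemma odd_sum_div_not_real:
  assumes "norm w < 1" "Im w > 0" "k \<ge> 1" "r \<noteq> 0"
  shows "odd_sum k w / (1 - w) \<noteq> of_real r"
proof
  assume r: "odd_sum k w / (1 - w) = of_real r"
  define U where "U = {z. norm z < 1 \<and> Im z > 0}"
  define g where "g = (\<lambda>z::complex. odd_sum k z / (1 - z))"
  have hol: "g holomorphic_on ball 0 1"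
    unfolding g_def by (rule holomorphic_odd_sum_div) simp
  have "open U" unfolding U_def by (intro open_Collect_conj open_Collect_less continuous_intros)
  show False
  proof (cases "g constant_on ball 0 1")
    case True
    then obtain a where a: "\<And>z. norm z < 1 \<Longrightarrow> g z = a" by (auto simp: constant_on_def)
    have "g 0 = 0" by (auto simp: g_def odd_sum_def intro!: sum.neutral)
    then have g0: "g z = 0" if "norm z < 1" for z using a[of 0] a[OF that] by simp
    show False using g0[OF assms(1)] r assms(4) by (simp add: g_def)
  next
    case False
    then have "open (g ` U)"
      by (intro open_mapping_thm[OF hol open_ball connected_ball \<open>open U\<close>]) (auto simp: U_def)
    moreover have "of_real r \<in> g ` U"
      using assms r by (auto simp: U_def g_def intro!: image_eqI[of _ _ w])
    ultimately obtain e where e: "e > 0" "ball (of_real r) e \<subseteq> g ` U"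
      using open_contains_ball by blast
    have "of_real r - \<i> * of_real (e / 2) \<in> ball (of_real r) e"
      using e(1) by (simp add: dist_norm norm_mult)
    then obtain z where "z \<in> U" "g z = of_real r - \<i> * of_real (e / 2)" using e(2) by fastforce
    then show False
      using Im_odd_sum_div_nonneg[of z k] assms(3) e(1) by (auto simp: U_def g_def)
  qed
qed

text \<open>Multiplied by \<open>(1 + t)\<^sup>2\<close>, the bound reduces to \<open>4 t < (1 + t)\<^sup>2\<close>.\<close>

lemma odd_sum_real_lower:
  assumes "0 < t" "t < 1" "k \<ge> 1"
  shows "odd_sum k (- t :: real) > - real k * (1 + t) / 2"
proof -
  have le_t: "(- t) ^ k \<le> t"
  proof -
    have "(- t) ^ k \<le> \<bar>- t\<bar> ^ k" by (metis abs_ge_self power_abs)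
    also have "\<dots> \<le> t" using assms power_decreasing[of 1 k t] by simp
    finally show ?thesis .
  qed
  have "(1 + t)\<^sup>2 * (- odd_sum k (- t)) = t * (2 * real k * (1 + t) - (1 - t) * (1 - (- t) ^ k))"
    using odd_sum_closed[of "- t" k] by simp
  \<comment> \<open>The subtracted product \<open>(1 - t) * (1 - (- t) ^ k)\<close> is nonnegative
    and is dropped.\<close>
  also have "\<dots> \<le> t * (2 * real k * (1 + t))"
  proof -
    have "(- t) ^ k \<le> 1" using le_t assms by simp
    then show ?thesis using assms by (intro mult_left_mono) auto
  qed
  also have "\<dots> = real k * (1 + t) / 2 * (4 * t)" by simp
  also have "\<dots> < real k * (1 + t) / 2 * (1 + t)\<^sup>2"
  proof -
    have "(1 + t)\<^sup>2 - 4 * t = (1 - t)\<^sup>2" by (simp add: power2_eq_square algebra_simps)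
    moreover have "(1 - t)\<^sup>2 > 0" using assms by simp
    ultimately have "4 * t < (1 + t)\<^sup>2" by linarith
    then show ?thesis using assms by (intro mult_strict_left_mono) auto
  qed
  finally have "(1 + t)\<^sup>2 * (- odd_sum k (- t)) < (1 + t)\<^sup>2 * (real k * (1 + t) / 2)"
    by (simp add: mult_ac)
  then show ?thesis using assms by (subst (asm) mult_less_cancel_left_pos) auto
qed

lemma odd_sum_real_nonneg: "0 \<le> t \<Longrightarrow> odd_sum k (t::real) \<ge> 0"
  unfolding odd_sum_def by (intro sum_nonneg) auto

text \<open>A zero forces \<open>g w = - 1 / a\<close>, a nonzero real number; this is impossible
  off the real axis. On the real axis the signs or the lower bound on \<open>odd_sum\<close>
  decide.\<close>

lemma reversed_poly_nonzero_in_disc: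
  fixes w :: complex
  assumes "norm w < 1" "k \<ge> 1" "0 \<le> x" "x \<le> 2 * real k"
  shows "1 - w + of_real (x / (real k)\<^sup>2) * odd_sum k w \<noteq> 0"
proof
  assume eq: "1 - w + of_real (x / (real k)\<^sup>2) * odd_sum k w = 0"
  have "w \<noteq> 1" using assms(1) by auto
  define a where "a = x / (real k)\<^sup>2"
  have "a \<ge> 0" using assms by (simp add: a_def)
  have eq': "1 - w = - of_real a * odd_sum k w" using eq by (simp add: a_def add_eq_0_iff)
  have "a \<noteq> 0" using eq' \<open>w \<noteq> 1\<close> by auto
  show False
  proof (cases "Im w = 0")
    case True
    define r where "r = Re w"
    have w: "w = of_real r" using True by (simp add: complex_eq_iff r_def)
    have r: "\<bar>r\<bar> < 1" using assms(1) w by simp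
    have "complex_of_real (1 - r) = of_real (- a * odd_sum k r)"
      using eq' unfolding w by (simp add: odd_sum_of_real)
    then have req: "1 - r = - a * odd_sum k r" using of_real_eq_iff by blast
    show False
    proof (cases "r \<ge> 0")
      case True
      then have "a * odd_sum k r \<ge> 0" using \<open>a \<ge> 0\<close> odd_sum_real_nonneg by simp
      then show False using req r by simp
    next
      case False
      \<comment> \<open>Here the bound on \<open>x\<close> enters:
        \<open>a * k / 2 = x / (2 * k)\<close> is at most 1.\<close>
      have "a * (- odd_sum k r) < a * (real k * (1 - r) / 2)"
        using odd_sum_real_lower[of "- r" k] r False assms(2) \<open>a \<ge> 0\<close> \<open>a \<noteq> 0\<close>
        by (intro mult_strict_left_mono) auto
      also have "\<dots> = x / (2 * real k) * (1 - r)"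
        using assms(2) by (simp add: a_def power2_eq_square field_simps)
      also have "\<dots> \<le> 1 * (1 - r)"
        using assms r by (intro mult_right_mono) auto
      finally show False using req by simp
    qed
  next
    case False
    have 1: "odd_sum k w / (1 - w) = of_real (- 1 / a)"
    proof -
      have "odd_sum k w \<noteq> 0" using eq' \<open>w \<noteq> 1\<close> by auto
      then show ?thesis unfolding eq' using \<open>a \<noteq> 0\<close> by (simp add: field_simps)
    qed
    show False
    proof (cases "Im w > 0")
      case True
      then show False using odd_sum_div_not_real[OF assms(1) True assms(2), of "- 1 / a"] 1 \<open>a \<noteq> 0\<close> by auto
    next
      case F: False
      \<comment> \<open>The coefficients are real, so conjugation carries the lower half disc to the
        upper one.\<close>
      have "odd_sum k (cnj w) / (1 - cnj w) = cnj (odd_sum k w / (1 - w))"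
        by (simp add: cnj_odd_sum)
      also have "\<dots> = of_real (- 1 / a)" unfolding 1 by simp
      finally show False
        using odd_sum_div_not_real[of "cnj w" k "- 1 / a"] F False assms(1,2) \<open>a \<noteq> 0\<close> by auto
    qed
  qed
qed

subsection \<open>The stability interval\<close>

definition odd_weights :: "nat \<Rightarrow> nat \<Rightarrow> real" where
  "odd_weights k j = (2 * real j + 1) / (real k)\<^sup>2"

lemma sum_odd_power_closed:
  fixes z :: "'a::comm_ring_1"
  shows "(z - 1)\<^sup>2 * (\<Sum>j<k. (2 * of_nat j + 1) * z ^ j) =
           2 * of_nat k * z ^ k * (z - 1) - (z + 1) * (z ^ k - 1)"
proof (induction k)
  case 0
  then show ?case by simp
next
  case (Suc k)
  then show ?case by (simp add: distrib_left) (simp add: algebra_simps power2_eq_square)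
qed

lemma poly_odd_adams:
  "poly (adams_poly k (odd_weights k) (of_real (- x))) z =
     z ^ k - z ^ (k - 1) + of_real (x / (real k)\<^sup>2) * (\<Sum>j<k. (2 * of_nat j + 1) * z ^ j)"
  by (simp add: poly_adams_poly odd_weights_def sum_distrib_left sum_negf mult_ac)

text \<open>Passing to \<open>1 / z\<close> turns roots outside the closed unit disc into zeros in
  the open disc.\<close>

lemma poly_odd_adams_reversed:
  assumes "z \<noteq> 0" "k \<ge> 1"
  shows "poly (adams_poly k (odd_weights k) (of_real (- x))) z =
     z ^ k * (1 - 1 / z + of_real (x / (real k)\<^sup>2) * odd_sum k (1 / z))"
proof -
  have "z ^ k * odd_sum k (1 / z) = (\<Sum>j<k. (2 * of_nat j + 1) * z ^ j)"
    unfolding odd_sum_def sum_distrib_left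
  proof (rule sum.cong[OF refl])
    fix j assume "j \<in> {..<k}"
    then have "z ^ k = z ^ (k - j) * z ^ j" by (simp flip: power_add)
    then show "z ^ k * ((2 * of_nat j + 1) * (1 / z) ^ (k - j)) = (2 * of_nat j + 1) * z ^ j"
      using assms(1) by (simp add: power_one_over)
  qed
  moreover have "z ^ (k - 1) = z ^ k * (1 / z)"
    using assms by (cases k) auto
  ultimately have "poly (adams_poly k (odd_weights k) (of_real (- x))) z =
      z ^ k - z ^ k * (1 / z) + of_real (x / (real k)\<^sup>2) * (z ^ k * odd_sum k (1 / z))"
    by (simp only: poly_odd_adams)
  then show ?thesis by (simp add: distrib_left right_diff_distrib mult_ac)
qed

section \<open>Roots on the unit circle and their multiplicity\<close>

text \<open>At a unit root \<open>g w\<close> is real, so the circle formula leaves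
  \<open>t = 0\<close>, that is \<open>w = - 1\<close>, or \<open>Re (w ^ k) = 1\<close>, that is
  \<open>w ^ k = 1\<close>. Evaluating \<open>odd_sum\<close> at 1 and at -1 gives the other two
  claims.\<close>

lemma odd_adams_unit_root:
  assumes "k \<ge> 1" "x > 0" "norm r = 1"
    and root: "poly (adams_poly k (odd_weights k) (of_real (- x))) r = 0"
  shows "r \<noteq> 1" "r ^ k = 1 \<or> r = - 1" "r = - 1 \<Longrightarrow> x = 2 * real k"
proof -
  define a where "a = x / (real k)\<^sup>2"
  have "a > 0" using assms by (simp add: a_def)
  define w where "w = 1 / r"
  have "r \<noteq> 0" "norm w = 1" using assms(3) by (auto simp: w_def norm_divide)
  have D: "1 - w + of_real a * odd_sum k w = 0"
    using root \<open>r \<noteq> 0\<close> poly_odd_adams_reversed[OF \<open>r \<noteq> 0\<close> assms(1), of x]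
    by (simp add: w_def a_def)
  show "r \<noteq> 1"
  proof
    assume "r = 1"
    then show False using D \<open>a > 0\<close> assms(1) by (simp add: w_def odd_sum_at_1)
  qed
  then have "w \<noteq> 1" by (auto simp: w_def)
  have D': "1 - w = - of_real a * odd_sum k w" using D by (simp add: add_eq_0_iff)
  then have "odd_sum k w \<noteq> 0" using \<open>w \<noteq> 1\<close> by auto
  then have "odd_sum k w / (1 - w) = of_real (- 1 / a)"
    unfolding D' using \<open>a > 0\<close> by (simp add: field_simps)
  moreover obtain t where t: "(1 + w) / (1 - w) = \<i> * of_real t"
    "Im (odd_sum k w / (1 - w)) = (t\<^sup>2 + 1) / 4 * t * Re (1 - w ^ k)"
    using Im_odd_sum_div_circle[OF \<open>norm w = 1\<close> \<open>w \<noteq> 1\<close>] by blast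
  ultimately have "(t\<^sup>2 + 1) / 4 * t * Re (1 - w ^ k) = 0" by (simp only: Im_complex_of_real)
  moreover have "t\<^sup>2 + 1 \<noteq> 0" using zero_le_power2[of t] by linarith
  ultimately consider "t = 0" | "Re (w ^ k) = 1" by auto
  then show "r ^ k = 1 \<or> r = - 1"
  proof cases
    case 1
    then have "w = - 1" using t(1) \<open>w \<noteq> 1\<close> by (simp add: add_eq_0_iff)
    then have "r = 1 / - 1" by (metis w_def divide_divide_eq_right mult_1 div_by_1)
    then show ?thesis by simp
  next
    case 2
    have "norm (w ^ k) = 1" using \<open>norm w = 1\<close> by (simp add: norm_power)
    then have "Im (w ^ k) = 0" using 2 by (simp add: cmod_def)
    then have "w ^ k = 1" using 2 by (simp add: complex_eq_iff)
    then show ?thesis using \<open>r \<noteq> 0\<close> by (simp add: w_def power_one_over)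
  qed
  show "x = 2 * real k" if "r = - 1"
  proof -
    have "odd_sum k w = - of_nat k"
      using odd_sum_of_real[of k "- 1"] that by (simp add: w_def odd_sum_at_minus_1)
    then have "complex_of_real (2 - a * real k) = 0" using D that by (simp add: w_def)
    then have "2 - a * real k = 0" using of_real_eq_0_iff by blast
    then show ?thesis using assms(1) by (simp add: a_def power2_eq_square field_simps)
  qed
qed

text \<open>A double root would make the derivative of \<open>(z - 1)^2\<close> times the polynomial
  vanish at \<open>r\<close>, which the closed form refutes. Parity matters at
  \<open>x = 2 * k\<close>: for even \<open>k\<close> the root -1 is double there.\<close>

lemma odd_adams_root_simple:
  assumes "k \<ge> 1" "0 \<le> x" "x < 2 * real k \<or> x = 2 * real k \<and> odd k" "norm r = 1"
    and root: "poly (adams_poly k (odd_weights k) (of_real (- x))) r = 0"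
  shows "\<not> [:- r, 1:]\<^sup>2 dvd adams_poly k (odd_weights k) (of_real (- x))"
proof
  let ?P = "adams_poly k (odd_weights k) (of_real (- x))"
  assume "[:- r, 1:]\<^sup>2 dvd ?P"
  then obtain Q where "?P = [:- r, 1:]\<^sup>2 * Q" by (elim dvdE)
  then have Q: "poly ?P z = (z - r)\<^sup>2 * poly Q z" for z
    by (simp add: poly_power)
  have r0: "r \<noteq> 0" using assms(4) by auto
  show False
  proof (cases "x = 0")
    case True
    have P: "poly ?P z = (z - 1) * z ^ (k - 1)" for z
      unfolding poly_odd_adams using True assms(1) by (cases k) (simp_all add: algebra_simps)
    have "r = 1" using root r0 unfolding P by auto
    have "((\<lambda>z. (z - 1) * z ^ (k - 1)) has_field_derivative 1) (at r)"
      unfolding \<open>r = 1\<close> by (auto intro!: derivative_eq_intros)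
    moreover have "((\<lambda>z. (z - r)\<^sup>2 * poly Q z) has_field_derivative 0) (at r)"
      by (auto intro!: derivative_eq_intros)
    ultimately show False
      using DERIV_unique unfolding P[symmetric] Q by fastforce
  next
    case False
    \<comment> \<open>Scaling by \<open>2 * k\<close> puts \<open>s\<close> in the interval from 0
      to 1 and makes the two closed-form terms carry \<open>4 * s\<close> and
      \<open>2 * s / k\<close>.\<close>
    define s where "s = complex_of_real (x / (2 * real k))"
    have "s \<noteq> 0" using False assms(1) by (simp add: s_def)
    define L where "L = (\<lambda>z. (z - 1) * z ^ (k - 1) * ((z - 1)\<^sup>2 + 4 * s * z)
                           - 2 * s / of_nat k * ((z + 1) * (z ^ k - 1)))"
    have L: "L z = (z - 1)\<^sup>2 * ((z - r)\<^sup>2 * poly Q z)" for z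
    proof -
      have zk: "z ^ k = z * z ^ (k - 1)" using assms(1) by (cases k) auto
      have x: "complex_of_real (x / (real k)\<^sup>2) = 2 * s / of_nat k"
        by (simp add: s_def power2_eq_square)
      have "(z - 1)\<^sup>2 * poly ?P z = (z - 1)\<^sup>2 * (z ^ k - z ^ (k - 1)) +
          2 * s / of_nat k * ((z - 1)\<^sup>2 * (\<Sum>j<k. (2 * of_nat j + 1) * z ^ j))"
        unfolding poly_odd_adams x by (simp add: algebra_simps)
      also have "\<dots> = (z - 1)\<^sup>2 * (z ^ k - z ^ (k - 1)) + 4 * s * z ^ k * (z - 1)
          - 2 * s / of_nat k * ((z + 1) * (z ^ k - 1))"
        unfolding sum_odd_power_closed using assms(1) by (simp add: right_diff_distrib)
      also have "\<dots> = L z"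
        unfolding L_def by (simp add: zk algebra_simps power2_eq_square)
      finally show ?thesis unfolding Q by simp
    qed
    have "r \<noteq> 1" "r ^ k = 1 \<or> r = - 1" and x: "r = - 1 \<Longrightarrow> x = 2 * real k"
      using odd_adams_unit_root[OF assms(1) _ assms(4) root] False assms(2) by auto
    define B where "B = (r - 1)\<^sup>2 + 4 * s * r"
    \<comment> \<open>Both kinds of unit root kill the last term of \<open>L\<close>, which leaves
      the quadratic condition \<open>B = 0\<close>.\<close>
    have "(r + 1) * (r ^ k - 1) = 0" using \<open>r ^ k = 1 \<or> r = - 1\<close> by auto
    then have "(r - 1) * r ^ (k - 1) * B = 0"
      using L[of r] unfolding L_def B_def by simp
    then have B: "B = 0" using \<open>r \<noteq> 1\<close> r0 by simp
    \<comment> \<open>The product rule is grouped so that its first part carries the factor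
      \<open>B\<close>, which is zero.\<close>
    have "(L has_field_derivative
        (r ^ (k - 1) + (r - 1) * (of_nat (k - 1) * r ^ (k - 1 - 1))) * B
          + (r - 1) * r ^ (k - 1) * (2 * (r - 1) + 4 * s)
          - 2 * s / of_nat k * ((r ^ k - 1) + (r + 1) * (of_nat k * r ^ (k - 1)))) (at r)"
      unfolding L_def B_def
      by (rule derivative_eq_intros refl | simp)+ (simp add: algebra_simps)
    moreover have "(L has_field_derivative 0) (at r)"
      unfolding L by (auto intro!: derivative_eq_intros)
    ultimately have deriv0: "(r - 1) * r ^ (k - 1) * (2 * (r - 1) + 4 * s)
          - 2 * s / of_nat k * ((r ^ k - 1) + (r + 1) * (of_nat k * r ^ (k - 1))) = 0"
      using DERIV_unique B by fastforce
    show False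
    proof (cases "r = - 1")
      case True
      then have "x = 2 * real k" "odd k" using x assms(3) by auto
      then have "s = 1" using assms(1) by (simp add: s_def)
      \<comment> \<open>With \<open>s = 1\<close> the first term vanishes at -1; for odd
        \<open>k\<close> the second leaves \<open>4 / k\<close>.\<close>
      then show False using deriv0 \<open>odd k\<close> assms(1) unfolding True by simp
    next
      case r: False
      then have "r ^ k = 1" using \<open>r ^ k = 1 \<or> r = - 1\<close> by simp
      then have "r ^ (k - 1) * ((r - 1) * (2 * (r - 1) + 4 * s) - 2 * s * (r + 1)) = 0"
        using deriv0 assms(1) by (simp add: algebra_simps)
      then have "(r - 1) * (2 * (r - 1) + 4 * s) - 2 * s * (r + 1) = 0" using r0 by simp
      \<comment> \<open>Subtracting \<open>2 * B\<close> eliminates the quadratic part and isolates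
        the factor \<open>r + 1\<close>.\<close>
      moreover have "(r - 1) * (2 * (r - 1) + 4 * s) - 2 * s * (r + 1) = 2 * B - 6 * s * (r + 1)"
        by (simp add: B_def algebra_simps power2_eq_square)
      ultimately have "s * (r + 1) = 0" using B by simp
      then show False using r \<open>s \<noteq> 0\<close> by (simp add: add_eq_0_iff2)
    qed
  qed
qed

section \<open>Length of the stability interval\<close>

lemma odd_adams_stable_on:
  assumes "k \<ge> 1" "l < 2 * real k \<or> l = 2 * real k \<and> odd k"
  shows "stable_on k (odd_weights k) l"
  unfolding stable_on_def
proof (rule image_subsetI)
  fix v assume v: "v \<in> {- l..0}"
  define x where "x = - v"
  have x: "0 \<le> x" "x < 2 * real k \<or> x = 2 * real k \<and> odd k" "x \<le> 2 * real k"
    using v assms(2) by (auto simp: x_def)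
  have "of_real (- x) \<in> stability_region k (odd_weights k)"
  proof (rule stability_region_if_root_condition[OF assms(1)])
    fix r assume root: "poly (adams_poly k (odd_weights k) (of_real (- x))) r = 0"
    have "norm r \<le> 1"
    proof (rule ccontr)
      assume "\<not> norm r \<le> 1"
      then have "r \<noteq> 0" "norm (1 / r) < 1" by (auto simp: norm_divide divide_less_eq_1)
      then show False
        using root reversed_poly_nonzero_in_disc[OF _ assms(1) x(1,3), of "1 / r"]
        unfolding poly_odd_adams_reversed[OF \<open>r \<noteq> 0\<close> assms(1)] by simp
    qed
    then show "norm r < 1 \<or> norm r = 1 \<and>
        \<not> [:- r, 1:]\<^sup>2 dvd adams_poly k (odd_weights k) (of_real (- x))"
      using odd_adams_root_simple[OF assms(1) x(1,2) _ root] by fastforce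
  qed
  then show "complex_of_real v \<in> stability_region k (odd_weights k)" by (simp add: x_def)
qed

lemma odd_adams_stable_on_le:
  assumes "k \<ge> 1" "0 \<le> l" "stable_on k (odd_weights k) l"
  shows "l \<le> 2 * real k"
proof (rule ccontr)
  assume "\<not> l \<le> 2 * real k"
  \<comment> \<open>The reversed polynomial on the real line: it is negative at -1 exactly when
    \<open>l > 2 * k\<close>, and equals 1 at 0. A zero strictly between gives a real root below
    -1.\<close>
  define h where "h = (\<lambda>w::real. 1 - w + l / (real k)\<^sup>2 * odd_sum k w)"
  have "h (- 1) = 2 - l / real k"
    by (simp add: h_def odd_sum_at_minus_1 power2_eq_square)
  moreover have "2 < l / real k"
    using \<open>\<not> l \<le> 2 * real k\<close> assms(1) by (simp add: less_divide_eq)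
  ultimately have "h (- 1) < 0" by simp
  have "h 0 = 1" by (auto simp: h_def odd_sum_def intro!: sum.neutral)
  have "continuous_on {- 1..0} h"
    unfolding h_def odd_sum_def by (intro continuous_intros)
  then obtain w where w: "- 1 \<le> w" "w \<le> 0" "h w = 0"
    using IVT'[of h "- 1" 0 0] \<open>h (- 1) < 0\<close> \<open>h 0 = 1\<close> by auto
  have "w \<noteq> - 1" "w \<noteq> 0" using w(3) \<open>h (- 1) < 0\<close> \<open>h 0 = 1\<close> by auto
  define r where "r = complex_of_real (1 / w)"
  have "r \<noteq> 0" "1 / r = of_real w" using \<open>w \<noteq> 0\<close> by (auto simp: r_def)
  have "norm r > 1" using w \<open>w \<noteq> - 1\<close> \<open>w \<noteq> 0\<close> unfolding r_def norm_of_real by (simp add: field_simps)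
  have "1 - of_real w + of_real (l / (real k)\<^sup>2) * odd_sum k (of_real w) = complex_of_real (h w)"
    unfolding h_def by (simp add: odd_sum_of_real)
  then have "poly (adams_poly k (odd_weights k) (of_real (- l))) r = 0"
    unfolding poly_odd_adams_reversed[OF \<open>r \<noteq> 0\<close> assms(1)] \<open>1 / r = of_real w\<close> w(3) by simp
  moreover have "of_real (- l) \<in> stability_region k (odd_weights k)"
    using assms(2,3) unfolding stable_on_def by fastforce
  ultimately show False using norm_root_le_1_if_stable[OF assms(1)] \<open>norm r > 1\<close> by fastforce
qed

lemma odd_adams_stability_length:
  assumes "k \<ge> 1"
  shows "stability_length k (odd_weights k) = ereal (2 * real k)"
  unfolding stability_length_def
proof (rule antisym)
  show "(SUP l\<in>{l. 0 \<le> l \<and> stable_on k (odd_weights k) l}. ereal l) \<le> ereal (2 * real k)"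
    using odd_adams_stable_on_le[OF assms] by (auto intro!: SUP_least)
  show "ereal (2 * real k) \<le> (SUP l\<in>{l. 0 \<le> l \<and> stable_on k (odd_weights k) l}. ereal l)"
  proof (rule ereal_le_epsilon2)
    fix e :: real assume "e > 0"
    \<comment> \<open>Staying strictly below \<open>2 * k\<close> makes the parity of
      \<open>k\<close> irrelevant; the maximum keeps \<open>l\<close> admissible for large
      \<open>e\<close>.\<close>
    define l where "l = max 0 (2 * real k - e)"
    have "l < 2 * real k" using assms \<open>e > 0\<close> by (simp add: l_def)
    then have "ereal l \<le> (SUP l\<in>{l. 0 \<le> l \<and> stable_on k (odd_weights k) l}. ereal l)"
      using odd_adams_stable_on[OF assms, of l] by (intro SUP_upper) (simp add: l_def)
    then have "ereal l + ereal e \<le> (SUP l\<in>{l. 0 \<le> l \<and> stable_on k (odd_weights k) l}. ereal l) + ereal e"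
      by (rule add_right_mono)
    moreover have "ereal (2 * real k) \<le> ereal l + ereal e"
      unfolding plus_ereal.simps ereal_less_eq by (simp add: l_def)
    ultimately show "ereal (2 * real k) \<le> (SUP l\<in>{l. 0 \<le> l \<and> stable_on k (odd_weights k) l}. ereal l) + ereal e"
      by (rule order.trans[rotated])
  qed
qed

subsection \<open>Order of consistency\<close>

lemma smooth_fun_deriv_bound:
  assumes "smooth_fun y"
  obtains K d where "d > 0" "K \<ge> 0" "\<And>s. 0 \<le> s \<Longrightarrow> s < d \<Longrightarrow> \<bar>deriv y (t + s) - deriv y t\<bar> \<le> K * s"
proof -
  have "(deriv ^^ 1) y differentiable (at t)" using assms unfolding smooth_fun_def by blast
  then obtain D where "(deriv y has_real_derivative D) (at t)"
    by (auto simp: real_differentiable_def)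
  then have "((\<lambda>h. (deriv y (t + h) - deriv y t) / h) \<longlongrightarrow> D) (at 0)"
    by (simp add: DERIV_def)
  then have "eventually (\<lambda>h. dist ((deriv y (t + h) - deriv y t) / h) D < 1) (at 0)"
    by (rule tendstoD) simp
  then obtain d where d: "d > 0"
    "\<And>h. h \<noteq> 0 \<Longrightarrow> \<bar>h\<bar> < d \<Longrightarrow> \<bar>(deriv y (t + h) - deriv y t) / h - D\<bar> < 1"
    by (auto simp: eventually_at dist_real_def)
  show ?thesis
  \<comment> \<open>The difference quotient stays within 1 of its limit \<open>D\<close>, whence the
    constant.\<close>
  proof (rule that[of d "\<bar>D\<bar> + 1"])
    fix s assume s: "0 \<le> s" "s < d"
    show "\<bar>deriv y (t + s) - deriv y t\<bar> \<le> (\<bar>D\<bar> + 1) * s"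
    proof (cases "s = 0")
      case False
      then have "\<bar>(deriv y (t + s) - deriv y t) / s\<bar> \<le> \<bar>D\<bar> + 1" using d(2)[of s] s by auto
      then show ?thesis using False s by (simp add: abs_divide divide_le_eq)
    qed simp
  qed (use d in auto)
qed

text \<open>The mean value theorem turns the remainder into \<open>s\<close> times an increment of
  \<open>deriv y\<close>, which is at most \<open>K * s\<close>.\<close>

lemma smooth_fun_taylor_bound:
  assumes "smooth_fun y" "0 \<le> s" "s < d" "K \<ge> 0"
    and K: "\<And>s. 0 \<le> s \<Longrightarrow> s < d \<Longrightarrow> \<bar>deriv y (t + s) - deriv y t\<bar> \<le> K * s"
  shows "\<bar>y (t + s) - y t - s * deriv y t\<bar> \<le> K * s\<^sup>2"
proof (cases "s = 0")
  case False
  have D: "(y has_real_derivative deriv y u) (at u)" for u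
  proof -
    have "(deriv ^^ 0) y differentiable (at u)" using assms(1) unfolding smooth_fun_def by blast
    then show ?thesis by (auto simp: real_differentiable_def DERIV_imp_deriv)
  qed
  obtain z where z: "t < z" "z < t + s" "y (t + s) - y t = (t + s - t) * deriv y z"
    using MVT2[of t "t + s" y "deriv y"] D False assms(2) by auto
  have "\<bar>y (t + s) - y t - s * deriv y t\<bar> = s * \<bar>deriv y (t + (z - t)) - deriv y t\<bar>"
    unfolding z(3) using assms(2) by (simp add: abs_mult flip: right_diff_distrib)
  also have "\<dots> \<le> s * (K * (z - t))"
    using K[of "z - t"] z assms(2,3) by (intro mult_left_mono) auto
  also have "\<dots> \<le> s * (K * s)"
    using z assms(2,4) by (intro mult_left_mono) auto
  finally show ?thesis by (simp add: power2_eq_square mult_ac)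
qed simp

text \<open>Expanding at \<open>t\<close>, the first-order terms cancel because
  \<open>k - (k - 1)\<close> equals the sum of the coefficients; only quadratic remainders
  survive.\<close>

lemma consistent_of_order_1:
  assumes "k \<ge> 1" and sum1: "(\<Sum>j<k. \<beta> j) = 1"
  shows "consistent_of_order k \<beta> 1"
  unfolding consistent_of_order_def
proof (intro allI impI)
  fix y :: "real \<Rightarrow> real" and t :: real
  assume sm: "smooth_fun y"
  obtain K d where K: "d > 0" "K \<ge> 0"
    "\<And>s. 0 \<le> s \<Longrightarrow> s < d \<Longrightarrow> \<bar>deriv y (t + s) - deriv y t\<bar> \<le> K * s"
    using smooth_fun_deriv_bound[OF sm] by blast
  define C where "C = K * (real k)\<^sup>2 + K * (real (k - 1))\<^sup>2 + (\<Sum>j<k. \<bar>\<beta> j\<bar> * (K * real j))"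
  \<comment> \<open>Below \<open>d / k\<close> all nodes up to index \<open>k\<close> lie within the
    radius of the derivative bound.\<close>
  have "eventually (\<lambda>\<tau>. \<tau> \<in> {0<..<d / real k}) (at_right 0)"
    using K(1) assms(1) by (intro eventually_at_right_real) simp
  then have "eventually (\<lambda>\<tau>. norm (truncation_error k \<beta> y t \<tau>) \<le> C * norm (\<tau> ^ (1 + 1))) (at_right 0)"
  proof (rule eventually_mono)
    fix \<tau> assume "\<tau> \<in> {0<..<d / real k}"
    then have \<tau>: "\<tau> > 0" "real k * \<tau> < d" using assms(1) by (auto simp: field_simps)
    have small: "0 \<le> real j * \<tau>" "real j * \<tau> < d" if "j \<le> k" for j
    proof -
      have "real j * \<tau> \<le> real k * \<tau>" using that \<tau> by (intro mult_right_mono) auto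
      then show "0 \<le> real j * \<tau>" "real j * \<tau> < d"
        using \<tau> order.strict_trans1 by (simp, blast)
    qed
    define R where "R = (\<lambda>j. y (t + real j * \<tau>) - y t - real j * \<tau> * deriv y t)"
    have R: "\<bar>R j\<bar> \<le> K * (real j)\<^sup>2 * \<tau>\<^sup>2" if "j \<le> k" for j
      using smooth_fun_taylor_bound[OF sm small[OF that] K(2,3)]
      unfolding R_def by (simp add: power_mult_distrib mult_ac)
    define S where "S = (\<Sum>j<k. \<beta> j * (deriv y (t + real j * \<tau>) - deriv y t))"
    have "\<bar>S\<bar> \<le> (\<Sum>j<k. \<bar>\<beta> j\<bar> * (K * real j)) * \<tau>"
      unfolding S_def sum_distrib_right
    proof (rule order.trans[OF sum_abs sum_mono])
      fix j assume "j \<in> {..<k}"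
      then show "\<bar>\<beta> j * (deriv y (t + real j * \<tau>) - deriv y t)\<bar> \<le> \<bar>\<beta> j\<bar> * (K * real j) * \<tau>"
        using K(3)[OF small[of j]] unfolding abs_mult mult.assoc by (intro mult_left_mono) auto
    qed
    then have S: "\<bar>\<tau> * S\<bar> \<le> (\<Sum>j<k. \<bar>\<beta> j\<bar> * (K * real j)) * \<tau>\<^sup>2"
      using \<tau>(1) by (simp add: abs_mult power2_eq_square mult_ac)
    have "S = (\<Sum>j<k. \<beta> j * deriv y (t + real j * \<tau>)) - deriv y t"
      using sum1 by (simp add: S_def right_diff_distrib sum_subtractf flip: sum_distrib_right)
    then have deriv_sum: "(\<Sum>j<k. \<beta> j * deriv y (t + real j * \<tau>)) = S + deriv y t" by simp
    have "truncation_error k \<beta> y t \<tau> = R k - R (k - 1) - \<tau> * S"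
      unfolding truncation_error_def deriv_sum R_def
      using assms(1) by (simp add: of_nat_diff algebra_simps)
    then have "\<bar>truncation_error k \<beta> y t \<tau>\<bar> \<le> \<bar>R k\<bar> + \<bar>R (k - 1)\<bar> + \<bar>\<tau> * S\<bar>" by linarith
    also have "\<dots> \<le> C * \<tau>\<^sup>2"
      using R[of k] R[of "k - 1"] S by (simp add: C_def distrib_right)
    finally show "norm (truncation_error k \<beta> y t \<tau>) \<le> C * norm (\<tau> ^ (1 + 1))"
      by (simp add: numeral_2_eq_2)
  qed
  then show "truncation_error k \<beta> y t \<in> O[at_right 0](\<lambda>\<tau>. \<tau> ^ (1 + 1))"
    by (rule bigoI)
qed

text \<open>The test function \<open>t^2\<close> has truncation error exactly
  \<open>c * \<tau>\<^sup>2\<close> at 0, and \<open>c\<close> is the defect in the second-order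
  condition.\<close>

lemma not_consistent_of_order_2:
  assumes "k \<ge> 1" and "2 * (\<Sum>j<k. \<beta> j * real j) \<noteq> 2 * real k - 1"
  shows "\<not> consistent_of_order k \<beta> 2"
proof
  assume "consistent_of_order k \<beta> 2"
  define y where "y = (\<lambda>t::real. t ^ 2)"
  have d1: "deriv y = (\<lambda>t. 2 * t)"
    unfolding y_def by (rule ext, rule DERIV_imp_deriv) (auto intro!: derivative_eq_intros)
  have dn: "(deriv ^^ Suc n) y = (\<lambda>t. if n = 0 then 2 * t else if n = 1 then 2 else 0)" for n
    by (simp add: funpow_Suc_right d1 del: funpow.simps)
  have "(deriv ^^ Suc n) y differentiable (at t)" for n t
    unfolding dn by (cases "n = 0"; cases "n = 1") auto
  moreover have "y differentiable (at t)" for t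
    unfolding y_def by (intro derivative_intros)
  ultimately have "smooth_fun y"
    unfolding smooth_fun_def by (metis funpow_0 not0_implies_Suc)
  define c where "c = (real k)\<^sup>2 - (real (k - 1))\<^sup>2 - 2 * (\<Sum>j<k. \<beta> j * real j)"
  have "(real (k - 1))\<^sup>2 = (real k)\<^sup>2 - 2 * real k + 1"
    using assms(1) by (simp add: of_nat_diff power2_eq_square algebra_simps)
  then have "c \<noteq> 0" using assms(2) by (simp add: c_def)
  have "truncation_error k \<beta> y 0 \<tau> = c * \<tau>\<^sup>2" for \<tau>
    unfolding truncation_error_def d1
    by (simp add: y_def c_def power2_eq_square sum_distrib_left sum_distrib_right algebra_simps)
  moreover have "truncation_error k \<beta> y 0 \<in> O[at_right 0](\<lambda>\<tau>. \<tau> ^ (2 + 1))"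
    using \<open>consistent_of_order k \<beta> 2\<close> \<open>smooth_fun y\<close> unfolding consistent_of_order_def by blast
  ultimately obtain K where K: "eventually (\<lambda>\<tau>. norm (c * \<tau>\<^sup>2) \<le> K * norm (\<tau> ^ (2 + 1))) (at_right 0)"
    by (auto elim!: landau_o.bigE)
  \<comment> \<open>Below this threshold \<open>(\<bar>K\<bar> + 1) * \<tau>\<close> is smaller than
    \<open>\<bar>c\<bar>\<close>; the added 1 keeps the denominator positive.\<close>
  have "eventually (\<lambda>\<tau>. \<tau> \<in> {0<..<\<bar>c\<bar> / (\<bar>K\<bar> + 1)}) (at_right 0)"
    using \<open>c \<noteq> 0\<close> by (intro eventually_at_right_real) simp
  with K have "eventually (\<lambda>\<tau>::real. False) (at_right 0)"
  proof eventually_elim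
    case (elim \<tau>)
    then have \<tau>: "\<tau> > 0" "\<tau> * (\<bar>K\<bar> + 1) < \<bar>c\<bar>" by (auto simp: less_divide_eq)
    have "\<tau>\<^sup>2 * \<bar>c\<bar> \<le> \<tau>\<^sup>2 * (K * \<tau>)"
      using elim(1) \<tau>(1) by (simp add: abs_mult power2_eq_square power3_eq_cube mult_ac)
    then have "\<bar>c\<bar> \<le> K * \<tau>"
      using \<tau>(1) by (subst (asm) mult_le_cancel_left_pos) auto
    also have "\<dots> \<le> (\<bar>K\<bar> + 1) * \<tau>" using \<tau>(1) by (intro mult_right_mono) auto
    finally show False using \<tau>(2) by (simp add: mult.commute)
  qed
  then show False by simp
qed

lemma odd_adams_has_order_1:
  assumes "k \<ge> 1"
  shows "has_order k (odd_weights k) 1"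
proof -
  have "(\<Sum>j<k. 2 * real j + 1) = (real k)\<^sup>2"
    by (induction k) (simp_all add: power2_eq_square algebra_simps)
  then have sum1: "(\<Sum>j<k. odd_weights k j) = 1"
    using assms by (simp add: odd_weights_def flip: sum_divide_distrib)
  \<comment> \<open>A weighted mean of indices is at most \<open>k - 1\<close>, whereas second order
    would need \<open>k - 1 / 2\<close>.\<close>
  have "(\<Sum>j<k. odd_weights k j * real j) \<le> (\<Sum>j<k. odd_weights k j * (real k - 1))"
    by (intro sum_mono mult_left_mono) (auto simp: odd_weights_def)
  also have "\<dots> = real k - 1"
    using sum1 by (simp flip: sum_distrib_right)
  finally have "2 * (\<Sum>j<k. odd_weights k j * real j) \<noteq> 2 * real k - 1" by simp
  then show ?thesis
    using consistent_of_order_1[OF assms sum1] not_consistent_of_order_2[OF assms]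
    by (simp add: has_order_def numeral_2_eq_2)
qed

theorem theorem1:
  fixes k :: nat
  assumes "k \<ge> 1"
  shows "\<exists>\<beta> :: nat \<Rightarrow> real.
           (\<forall>j<k. \<beta> j = (2 * real j + 1) / (real k)\<^sup>2) \<and>
           has_order k \<beta> 1 \<and>
           stability_length k \<beta> = ereal (2 * real k) \<and>
           (odd k \<longrightarrow> stable_on k \<beta> (2 * real k))"
  using odd_adams_has_order_1[OF assms] odd_adams_stability_length[OF assms]
    odd_adams_stable_on[OF assms, of "2 * real k"]
  by (intro exI[of _ "odd_weights k"]) (simp add: odd_weights_def)

end
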